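(* Let $f$ be the morphism on $\{0,1,2\}^*$ defined by $f(0)=012\,021\,201\,021\,012\,102\,120\,210$, $f(1)=120\,102\,012\,102\,120\,210\,201\,021$, $f(2)=201\,210\,120\,210\,201\,021\,012\,102$ (each image has length $24$; spaces are only for readability), and let $f^\omega(0)$ be its infinite fixed point beginning with $0$. Then $f^\omega(0)$ is undirected $\tfrac{7}{4}^+$-free.
   Context: For a word $x=x_1\cdots x_n$ (letters $x_i$), its reversal is $x^R=x_n\cdots x_1$. For rational $1<r\leq 2$, an undirected $r$-power is a word $xyx'$ with $x$ nonempty, $x'\in\{x,x^R\}$, and $|xyx'|/|xy|=r$. A word is undirected $\alpha^+$-free if none of its factors is an undirected $r$-power for any rational $r>\alpha$. *)

theory Defs
  imports Complex_Main "HOL-Library.Stream"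
begin

text \<open>Finite words are lists, infinite words are streams.\<close>

definition undirected_power :: "rat \<Rightarrow> 'a list \<Rightarrow> bool" where
  "undirected_power r w \<longleftrightarrow> 1 < r \<and> r \<le> 2 \<and>
     (\<exists>x y x'. w = x @ y @ x' \<and> x \<noteq> [] \<and> x' \<in> {x, rev x} \<and>
        of_nat (length (x @ y @ x')) / of_nat (length (x @ y)) = r)"

definition stream_factor :: "'a list \<Rightarrow> 'a stream \<Rightarrow> bool" where
  "stream_factor u s \<longleftrightarrow> (\<exists>p t. s = p @- u @- t)"

definition undirected_plus_free :: "real \<Rightarrow> 'a stream \<Rightarrow> bool" where
  "undirected_plus_free \<alpha> s \<longleftrightarrow>
     (\<forall>u r. stream_factor u s \<longrightarrow> of_rat r > \<alpha> \<longrightarrow> \<not> undirected_power r u)"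

datatype letter = L0 | L1 | L2

primrec f_letter :: "letter \<Rightarrow> letter list" where
  "f_letter L0 = [L0,L1,L2, L0,L2,L1, L2,L0,L1, L0,L2,L1, L0,L1,L2, L1,L0,L2, L1,L2,L0, L2,L1,L0]"
| "f_letter L1 = [L1,L2,L0, L1,L0,L2, L0,L1,L2, L1,L0,L2, L1,L2,L0, L2,L1,L0, L2,L0,L1, L0,L2,L1]"
| "f_letter L2 = [L2,L0,L1, L2,L1,L0, L1,L2,L0, L2,L1,L0, L2,L0,L1, L0,L2,L1, L0,L1,L2, L1,L0,L2]"

definition f_word :: "letter list \<Rightarrow> letter list" where
  "f_word w = concat (map f_letter w)"

text \<open>
  The fixed point is the limit of the words \<open>f\<^sup>n(0)\<close>, each of which is a prefix of the next.
  As \<open>f\<^sup>n(0)\<close> has length \<open>24\<^sup>n > n\<close>, its letter at position \<open>n\<close> is the one of the limit.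
  The lemmas \<open>f_omega_fixed_point\<close> and \<open>f_omega_unique\<close> below say that this stream is the
  only fixed point of (the extension to streams of) the morphism that begins with \<open>0\<close>.
\<close>

definition f_omega :: "letter stream" where
  "f_omega = smap (\<lambda>n. (f_word ^^ n) [L0] ! n) nats"

lemma length_f_letter [simp]: "length (f_letter a) = 24"
  by (cases a) simp_all

lemma f_letter_neq_Nil [simp]: "f_letter a \<noteq> []"
  using length_f_letter[of a] by (metis length_0_conv zero_neq_numeral)

lemma length_f_word [simp]: "length (f_word w) = 24 * length w"
  by (induction w) (simp_all add: f_word_def)

lemma length_f_word_funpow: "length ((f_word ^^ n) [L0]) = 24 ^ n"
  by (induction n) simp_all

lemma f_word_append: "f_word (u @ v) = f_word u @ f_word v"
  by (simp add: f_word_def)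

lemma f_word_nth:
  "i < 24 * length w \<Longrightarrow> f_word w ! i = f_letter (w ! (i div 24)) ! (i mod 24)"
proof (induction w arbitrary: i)
  case (Cons a w)
  show ?case
  proof (cases "i < 24")
    case True
    then show ?thesis by (simp add: f_word_def nth_append)
  next
    case False
    then obtain j where j: "i = 24 + j" using le_Suc_ex not_less by blast
    have "f_word (a # w) ! i = f_word w ! j"
      by (simp add: f_word_def nth_append j)
    with Cons j show ?thesis by simp
  qed
qed simp

lemma flat_smap_f_letter_nth:
  "flat (smap f_letter s) !! i = f_letter (s !! (i div 24)) ! (i mod 24)"
proof (induction i arbitrary: s rule: less_induct)
  case (less i)
  have eq: "flat (smap f_letter s) !! i =
      (if i < 24 then f_letter (shd s) ! i else flat (smap f_letter (stl s)) !! (i - 24))"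
    by (subst flat_snth) (auto simp: stream.set_map)
  show ?case
  proof (cases "i < 24")
    case True
    then show ?thesis by (simp add: eq)
  next
    case False
    then obtain j where j: "i = 24 + j" using le_Suc_ex not_less by blast
    then show ?thesis using less.IH[of j "stl s"] eq by simp
  qed
qed

lemma f_word_funpow_prefix: "\<exists>v. (f_word ^^ (n + k)) [L0] = (f_word ^^ n) [L0] @ v"
proof -
  have step: "\<exists>v. (f_word ^^ Suc m) [L0] = (f_word ^^ m) [L0] @ v" for m
  proof (induction m)
    case 0
    show ?case by (simp add: f_word_def)
  next
    case (Suc m)
    then obtain v where "(f_word ^^ Suc m) [L0] = (f_word ^^ m) [L0] @ v" ..
    then have "(f_word ^^ Suc (Suc m)) [L0] = (f_word ^^ Suc m) [L0] @ f_word v"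
      by (metis comp_apply f_word_append funpow.simps(2))
    then show ?case ..
  qed
  show ?thesis
  proof (induction k)
    case (Suc k)
    then show ?case using step[of "n + k"] by (metis add_Suc_right append.assoc)
  qed simp
qed

lemma f_omega_nth:
  assumes "i < 24 ^ n"
  shows "f_omega !! i = (f_word ^^ n) [L0] ! i"
proof -
  have lt: "i < 24 ^ i" by (induction i) simp_all
  have "(f_word ^^ i) [L0] ! i = (f_word ^^ n) [L0] ! i"
  proof (cases "i \<le> n")
    case True
    with f_word_funpow_prefix[of i "n - i"] lt show ?thesis
      by (auto simp: nth_append length_f_word_funpow)
  next
    case False
    with f_word_funpow_prefix[of n "i - n"] assms show ?thesis
      by (auto simp: nth_append length_f_word_funpow)
  qed
  then show ?thesis by (simp add: f_omega_def)
qed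

lemma f_omega_shd: "shd f_omega = L0"
  using f_omega_nth[of 0 0] by simp

lemma f_omega_fixed_point: "flat (smap f_letter f_omega) = f_omega"
proof -
  have "flat (smap f_letter f_omega) !! i = f_omega !! i" for i
  proof -
    have lt: "i < 24 ^ i" by (induction i) simp_all
    then have lt': "i < 24 * 24 ^ i" by simp
    have "f_omega !! i = f_word ((f_word ^^ i) [L0]) ! i"
      using f_omega_nth[of i "Suc i"] lt' by simp
    also have "\<dots> = f_letter ((f_word ^^ i) [L0] ! (i div 24)) ! (i mod 24)"
      using lt' by (intro f_word_nth) (simp add: length_f_word_funpow)
    also have "(f_word ^^ i) [L0] ! (i div 24) = f_omega !! (i div 24)"
      using lt by (intro f_omega_nth[symmetric]) (meson div_le_dividend le_less_trans)
    finally show ?thesis by (simp add: flat_smap_f_letter_nth)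
  qed
  then show ?thesis using smap_alt[of id] by (metis id_apply stream.map_id)
qed

lemma f_omega_unique:
  assumes "flat (smap f_letter s) = s" and "shd s = L0"
  shows "s = f_omega"
proof -
  have "s !! i = f_omega !! i" for i
  proof (induction i rule: less_induct)
    case (less i)
    show ?case
    proof (cases "i = 0")
      case True
      then show ?thesis using assms(2) f_omega_shd by simp
    next
      case False
      then have "s !! (i div 24) = f_omega !! (i div 24)" by (intro less) simp
      then show ?thesis
        using flat_smap_f_letter_nth[of s i] flat_smap_f_letter_nth[of f_omega i]
        by (simp add: assms(1) f_omega_fixed_point)
    qed
  qed
  then show ?thesis using smap_alt[of id] by (metis id_apply stream.map_id)
qed

end

theory Submission
  imports Defs
begin

text \<open>
  The words \<open>f(0)\<close>, \<open>f(1)\<close>, \<open>f(2)\<close> differ in every position, so equality of two letters of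
  \<open>f\<^sup>\<omega>(0)\<close> at positions congruent modulo 24 forces equality of their parent letters.  A factor of
  length 16 occurs at positions of one residue class modulo 24 only.  Hence a repetition of
  period \<open>p \<ge> 20\<close> and exponent greater than \<open>7/4\<close>, in which at least 16 letters are repeated, has
  \<open>p\<close> divisible by 24, and taking parents gives a repetition of period \<open>p/24\<close> whose exponent is
  again greater than \<open>7/4\<close>; this descends to \<open>p < 20\<close>.  No factor of length 19 has its reversal as
  a factor, which bounds the words \<open>xyx\<^sup>R\<close> to be considered.  The remaining short factors all lie in
  \<open>f(abc)\<close> with \<open>a \<noteq> b \<noteq> c\<close> and are checked by computation.
\<close>

section \<open>Factors of the fixed point and their parent letters\<close>

definition window :: "nat \<Rightarrow> nat \<Rightarrow> letter list" where
  "window i n = map (snth f_omega) [i..<i + n]"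

lemma length_window [simp]: "length (window i n) = n"
  by (simp add: window_def)

lemma window_nth [simp]: "k < n \<Longrightarrow> window i n ! k = f_omega !! (i + k)"
  by (simp add: window_def)

lemma take_window: "k \<le> n \<Longrightarrow> take k (window i n) = window i k"
  by (rule nth_equalityI) auto

lemma take_drop_window: "j + k \<le> n \<Longrightarrow> take k (drop j (window i n)) = window (i + j) k"
  by (rule nth_equalityI) (auto simp: add.assoc)

lemma f_omega_snth: "f_omega !! i = f_letter (f_omega !! (i div 24)) ! (i mod 24)"
  by (metis f_omega_fixed_point flat_smap_f_letter_nth)

lemma in_letters: "a \<in> set [L0, L1, L2]"
  by (cases a) simp_all

lemma f_letter_nth_inj:
  assumes "f_letter a ! j = f_letter b ! j" and "j < 24"
  shows "a = b"
proof -
  have "\<forall>a\<in>set [L0, L1, L2]. \<forall>b\<in>set [L0, L1, L2]. \<forall>j\<in>set [0..<24].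
      f_letter a ! j = f_letter b ! j \<longrightarrow> a = b"
    by code_simp
  moreover have "j \<in> set [0..<24]" using assms(2) by simp
  ultimately show ?thesis using assms(1) in_letters by blast
qed

lemma f_letter_nth_Suc_neq:
  assumes "j < 23"
  shows "f_letter a ! j \<noteq> f_letter a ! Suc j"
proof -
  have "\<forall>a\<in>set [L0, L1, L2]. \<forall>j\<in>set [0..<23]. f_letter a ! j \<noteq> f_letter a ! Suc j"
    by code_simp
  moreover have "j \<in> set [0..<23]" using assms by simp
  ultimately show ?thesis using in_letters by blast
qed

lemma f_letter_last_eq_first: "f_letter a ! 23 = f_letter a ! 0"
  by (cases a) simp_all

text \<open>Inside a block this is a check of the images. At a border, an image ends with the letter
  it begins with, and first letters determine parents, so equal letters would come from equal
  neighbouring parents.\<close>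

lemma f_omega_Suc_neq: "f_omega !! i \<noteq> f_omega !! Suc i"
proof (induction i rule: less_induct)
  case (less i)
  show ?case
  proof (cases "i mod 24 = 23")
    case True
    then have "i \<noteq> 0" by auto
    then have "f_omega !! (i div 24) \<noteq> f_omega !! Suc (i div 24)"
      by (intro less.IH) simp
    moreover have "Suc i div 24 = Suc (i div 24)" "Suc i mod 24 = 0"
      using True by (simp_all add: div_Suc mod_Suc)
    ultimately show ?thesis
      using True f_letter_nth_inj[of _ 0]
      by (auto simp: f_omega_snth[of i] f_omega_snth[of "Suc i"] f_letter_last_eq_first
          simp del: snth.simps)
  next
    case False
    then have "Suc i div 24 = i div 24" "Suc i mod 24 = Suc (i mod 24)" "i mod 24 < 23"
      by (auto simp: div_Suc mod_Suc)
    then show ?thesis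
      using f_letter_nth_Suc_neq
      by (simp add: f_omega_snth[of i] f_omega_snth[of "Suc i"] del: snth.simps)
  qed
qed

section \<open>Finite checks on short factors\<close>

text \<open>The first components are offsets, which are the residues modulo 24 of the positions in the
  fixed point at which the second components can occur.\<close>

definition factor_table :: "nat \<Rightarrow> nat \<Rightarrow> (nat \<times> letter list) list" where
  "factor_table n m = [(j, take n (drop j (f_word u))).
     u \<leftarrow> filter distinct_adj (List.n_lists m [L0, L1, L2]), j \<leftarrow> [0..<24]]"

text \<open>A factor starts at offset at most 23 of its first block, so the bound keeps it inside
  \<open>m\<close> consecutive blocks; by \<open>f_omega_Suc_neq\<close> the filter keeps the word
  of their parents.\<close>

lemma window_in_factor_table:
  assumes "n + 23 \<le> 24 * m"
  shows "(i mod 24, window i n) \<in> set (factor_table n m)"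
proof -
  let ?u = "window (i div 24) m"
  have "distinct_adj ?u"
    using f_omega_Suc_neq by (simp add: distinct_adj_conv_nth del: snth.simps)
  moreover have "set ?u \<subseteq> {L0, L1, L2}"
    using in_letters by auto
  moreover have "window i n = take n (drop (i mod 24) (f_word ?u))"
  proof (rule nth_equalityI)
    have len: "i mod 24 + n \<le> 24 * m"
      using assms mod_less_divisor[of 24 i] by linarith
    then show "length (window i n) = length (take n (drop (i mod 24) (f_word ?u)))"
      by simp
    fix k assume "k < length (window i n)"
    then have k: "k < n" by simp
    let ?t = "i mod 24 + k"
    have t: "?t < 24 * m" using k len by simp
    then have "?t div 24 < m" by (simp add: less_mult_imp_div_less mult.commute)
    moreover have "i + k = 24 * (i div 24) + ?t" by simp
    then have "(i + k) div 24 = i div 24 + ?t div 24" "(i + k) mod 24 = ?t mod 24"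
      by (metis div_mult_self4 zero_neq_numeral, metis mod_mult_self4)
    ultimately show "window i n ! k = take n (drop (i mod 24) (f_word ?u)) ! k"
      using k len t f_omega_snth[of "i + k"] by (simp add: f_word_nth)
  qed
  ultimately show ?thesis
    by (force simp: factor_table_def set_n_lists)
qed

definition synchronizing :: "('a \<times> 'b) list \<Rightarrow> bool" where
  "synchronizing T \<longleftrightarrow> (\<forall>(j, u) \<in> set T. \<forall>(k, v) \<in> set T. u = v \<longrightarrow> j = k)"

definition reversal_free :: "('a \<times> 'b list) list \<Rightarrow> bool" where
  "reversal_free T \<longleftrightarrow>
     (\<forall>(j, u) \<in> set T. let u' = rev u in \<forall>(k, v) \<in> set T. v \<noteq> u')"

text \<open>Here \<open>l\<close> is the least overlap for which the exponent (p + l) / p exceeds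
  7/4.\<close>

definition short_repetition_free :: "('a \<times> 'b list) list \<Rightarrow> bool" where
  "short_repetition_free T \<longleftrightarrow> (\<forall>(j, u) \<in> set T. \<forall>p \<in> set [1..<20].
     let l = 3 * p div 4 + 1 in take l u \<noteq> take l (drop p u))"

text \<open>For |x| = l and |y| = m, the exponent (2l + m) / (l + m) exceeds 7/4 exactly if l > 3m,
  so \<open>l\<close> is the least such length.\<close>

definition short_reversal_free :: "('a \<times> 'b list) list \<Rightarrow> bool" where
  "short_reversal_free T \<longleftrightarrow> (\<forall>(j, u) \<in> set T. \<forall>m \<in> set [0..<6].
     let l = 3 * m + 1 in take l (drop (l + m) u) \<noteq> rev (take l u))"

lemma synchronizingD:
  "synchronizing T \<Longrightarrow> (j, u) \<in> set T \<Longrightarrow> (k, u) \<in> set T \<Longrightarrow> j = k"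
  by (auto simp: synchronizing_def)

lemma reversal_freeD:
  "reversal_free T \<Longrightarrow> (j, u) \<in> set T \<Longrightarrow> (k, v) \<in> set T \<Longrightarrow> v \<noteq> rev u"
  by (auto simp: reversal_free_def)

lemma short_repetition_freeD:
  "short_repetition_free T \<Longrightarrow> (j, u) \<in> set T \<Longrightarrow> 0 < p \<Longrightarrow> p < 20 \<Longrightarrow>
   take (3 * p div 4 + 1) u \<noteq> take (3 * p div 4 + 1) (drop p u)"
  unfolding short_repetition_free_def Let_def by fastforce

lemma short_reversal_freeD:
  "short_reversal_free T \<Longrightarrow> (j, u) \<in> set T \<Longrightarrow> m < 6 \<Longrightarrow>
   take (3 * m + 1) (drop (3 * m + 1 + m) u) \<noteq> rev (take (3 * m + 1) u)"
  unfolding short_reversal_free_def Let_def by fastforce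

lemma synchronizing_factor_table: "synchronizing (factor_table 16 2)"
  by code_simp

lemma reversal_free_factor_table: "reversal_free (factor_table 19 2)"
  by code_simp

text \<open>Length 34 accommodates the largest case \<open>p = 19\<close> with overlap 15.\<close>

lemma short_repetition_free_factor_table: "short_repetition_free (factor_table 34 3)"
  by code_simp

text \<open>Length 37 = 16 + 5 + 16 accommodates the largest case \<open>m = 5\<close>.\<close>

lemma short_reversal_free_factor_table: "short_reversal_free (factor_table 37 3)"
  by code_simp

lemma window_16_synchronizing:
  assumes "window i 16 = window k 16"
  shows "i mod 24 = k mod 24"
proof (rule synchronizingD[OF synchronizing_factor_table])
  show "(i mod 24, window i 16) \<in> set (factor_table 16 2)"
    by (rule window_in_factor_table) simp
  show "(k mod 24, window i 16) \<in> set (factor_table 16 2)"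
    unfolding assms by (rule window_in_factor_table) simp
qed

lemma window_19_reversal_free: "window k 19 \<noteq> rev (window i 19)"
  by (rule reversal_freeD[OF reversal_free_factor_table]; rule window_in_factor_table) simp_all

lemma window_short_repetition_free:
  assumes "0 < p" "p < 20"
  shows "window a (3 * p div 4 + 1) \<noteq> window (a + p) (3 * p div 4 + 1)"
proof -
  let ?l = "3 * p div 4 + 1"
  have "take ?l (window a 34) \<noteq> take ?l (drop p (window a 34))"
    using assms
    by (intro short_repetition_freeD[OF short_repetition_free_factor_table window_in_factor_table]) simp_all
  moreover have "p + ?l \<le> 34" using assms by linarith
  ultimately show ?thesis by (simp add: take_window take_drop_window)
qed

lemma window_short_reversal_free:
  assumes "m < 6"
  shows "window (a + (4 * m + 1)) (3 * m + 1) \<noteq> rev (window a (3 * m + 1))"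
proof -
  let ?l = "3 * m + 1"
  have "take ?l (drop (?l + m) (window a 37)) \<noteq> rev (take ?l (window a 37))"
    using assms
    by (intro short_reversal_freeD[OF short_reversal_free_factor_table window_in_factor_table]) simp_all
  moreover have "?l + m + ?l \<le> 37" "?l + m = 4 * m + 1" using assms by linarith+
  ultimately show ?thesis by (simp add: take_window take_drop_window)
qed

section \<open>Repetitions and reversed repetitions of any length\<close>

lemma no_repetition:
  assumes "0 < p" "3 * p < 4 * l"
  shows "window a l \<noteq> window (a + p) l"
  using assms
proof (induction p arbitrary: a l rule: less_induct)
  case (less p)
  show ?case
  proof
    assume rep: "window a l = window (a + p) l"
    have eq: "f_omega !! t = f_omega !! (t + p)" if "a \<le> t" "t < a + l" for t
    proof -
      have "window a l ! (t - a) = window (a + p) l ! (t - a)" by (simp only: rep)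
      then show ?thesis using that by (simp add: add.commute add.left_commute)
    qed
    show False
    proof (cases "p < 20")
      case True
      have "3 * p div 4 + 1 \<le> l" using less.prems by linarith
      then have "window a (3 * p div 4 + 1) = window (a + p) (3 * p div 4 + 1)"
        by (metis rep take_window)
      then show False using window_short_repetition_free less.prems(1) True by blast
    next
      case False
      then have "16 \<le> l" using less.prems by linarith
      then have "window a 16 = window (a + p) 16" by (metis rep take_window)
      then have "a mod 24 = (a + p) mod 24" by (rule window_16_synchronizing)
      then have "24 dvd p" by (metis add_diff_cancel_left' le_add1 mod_eq_dvd_iff_nat)
      then obtain p' where p': "p = 24 * p'" ..
      define a' where "a' = a div 24"
      define l' where "l' = (a + l - 1) div 24 + 1 - a'"
      have l': "3 * p' < 4 * l'"
        using less.prems(2) \<open>16 \<le> l\<close> unfolding p' l'_def a'_def by linarith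
      have "window a' l' = window (a' + p') l'"
      proof (rule nth_equalityI)
        fix i assume "i < length (window a' l')"
        then have i: "i < l'" by simp
        \<comment> \<open>The first position of block \<open>a' + i\<close> inside the repeated
          stretch; only block \<open>a'\<close> may be entered after its start.\<close>
        define t where "t = (if i = 0 then a else 24 * (a' + i))"
        have t: "a \<le> t \<and> t < a + l \<and> t div 24 = a' + i"
        proof (cases "i = 0")
          case True
          then show ?thesis using \<open>16 \<le> l\<close> by (simp add: t_def a'_def)
        next
          case False
          have "a' + i \<le> (a + l - 1) div 24" using i by (simp add: l'_def)
          then have "24 * (a' + i) \<le> a + l - 1"
            by (simp add: less_eq_div_iff_mult_less_eq mult.commute)
          then have "24 * (a' + i) < a + l" using \<open>16 \<le> l\<close> by linarith
          moreover have "a \<le> 24 * (a' + i)"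
            using False mod_less_divisor[of 24 a] by (simp add: a'_def)
          ultimately show ?thesis using False by (simp add: t_def)
        qed
        have "(t + p) div 24 = a' + i + p'" "(t + p) mod 24 = t mod 24"
          using t by (simp_all add: p')
        then have "f_letter (f_omega !! (a' + i)) ! (t mod 24) =
            f_letter (f_omega !! (a' + i + p')) ! (t mod 24)"
          by (metis eq f_omega_snth t)
        then have "f_omega !! (a' + i) = f_omega !! (a' + i + p')"
          by (rule f_letter_nth_inj) simp
        then show "window a' l' ! i = window (a' + p') l' ! i"
          using i by (simp add: add.commute add.left_commute)
      qed simp
      moreover have "window a' l' \<noteq> window (a' + p') l'"
        using less.prems(1) l' by (intro less.IH) (simp_all add: p')
      ultimately show False by contradiction
    qed
  qed
qed

text \<open>Trimming equally many letters from both ends keeps the middle gap and the mirror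
  symmetry, so the length \<open>l\<close> can be cut to one that was checked.\<close>

lemma no_reversed_repetition:
  assumes "3 * m < l"
  shows "window (a + l + m) l \<noteq> rev (window a l)"
proof
  assume rev: "window (a + l + m) l = rev (window a l)"
  have inner: "window (a + l + m) k = rev (window (a + l - k) k)" if "k \<le> l" for k
  proof -
    have "window (a + l + m) k = take k (rev (window a l))"
      using that by (simp add: take_window flip: rev)
    also have "\<dots> = rev (take k (drop (l - k) (window a l)))"
      using that by (simp add: take_rev)
    also have "take k (drop (l - k) (window a l)) = window (a + l - k) k"
      using that by (simp only: take_drop_window le_add_diff_inverse2 Nat.add_diff_assoc)
    finally show ?thesis .
  qed
  show False
  proof (cases "m < 6")
    case True
    have "a + l - (3 * m + 1) + (4 * m + 1) = a + l + m" using assms by simp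
    then show False
      using window_short_reversal_free[OF True, of "a + l - (3 * m + 1)"] inner[of "3 * m + 1"] assms
      by (simp add: add.commute)
  next
    case False
    \<comment> \<open>From \<open>m \<ge> 6\<close> follows \<open>l \<ge> 19\<close>, and the 19
      letters on either side of the gap are mirror images.\<close>
    then show False using window_19_reversal_free inner[of 19] assms by auto
  qed
qed

theorem theorem4:
  shows "undirected_plus_free (7/4) f_omega"
  unfolding undirected_plus_free_def
proof (intro allI impI notI)
  fix u and r :: rat
  assume fac: "stream_factor u f_omega" and r: "of_rat r > (7/4 :: real)"
    and pow: "undirected_power r u"
  from fac obtain q t where q: "f_omega = q @- u @- t"
    unfolding stream_factor_def by blast
  from pow obtain x y x' where u: "u = x @ y @ x'" and ne: "x \<noteq> []" and x': "x' \<in> {x, rev x}"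
    and ratio: "of_nat (length (x @ y @ x')) / of_nat (length (x @ y)) = r"
    unfolding undirected_power_def by blast
  define a l m where "a = length q" and "l = length x" and "m = length y"
  have l: "0 < l" and lx': "length x' = l" using ne x' by (auto simp: l_def)
  have "(7/4 :: rat) < r"
    using r by (metis of_rat_divide of_rat_less of_rat_numeral_eq)
  with ratio have "(7/4 :: rat) < of_nat (l + m + l) / of_nat (l + m)"
    by (simp add: lx' l_def m_def add.assoc)
  then have "(7 :: rat) * of_nat (l + m) < 4 * of_nat (l + m + l)"
    using l by (simp add: field_simps)
  then have "7 * (l + m) < 4 * (l + m + l)"
    by (metis of_nat_less_iff of_nat_mult of_nat_numeral)
  \<comment> \<open>This bound serves both cases: for the period p = l + m of an unreversed
    repetition it reads 3p < 4l.\<close>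
  then have lm: "3 * m < l" by simp
  have nth: "f_omega !! (a + k) = u ! k" if "k < length u" for k
    using that by (simp add: q a_def)
  have wx: "window a l = x"
    by (rule nth_equalityI) (auto simp: l_def nth u nth_append)
  have wx': "window (a + l + m) l = x'"
    using lx' by (intro nth_equalityI) (auto simp: l_def m_def nth u nth_append add.assoc)
  from x' show False
  proof
    assume "x' = x"
    then show False using no_repetition[of "l + m" l a] lm l wx wx' by (simp add: add.assoc)
  next
    assume "x' \<in> {rev x}"
    then show False using no_reversed_repetition[OF lm, of a] wx wx' by simp
  qed
qed

end
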